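(* Let $f$ be a continuous doubling gauge function and let $X$ be a compact metric space. Let $A \subseteq \omega^\omega \times X$ be a $\boldsymbol{\Sigma}^1_1$ set such that $x \le x'$ (pointwise) implies $A_x \subseteq A_{x'}$, and such that $\mathcal{H}^f(A_x) = 0$ for every $x \in \omega^\omega$. Then $\mathcal{H}^f\big(\bigcup_{x\in\omega^\omega} A_x\big) = 0$. (That is, $\mathsf{GP}(\boldsymbol{\Sigma}^1_1, \mathcal{N}^f_X)$ holds.)
   Context: A gauge function is a right-continuous nondecreasing $f:[0,\infty)\to[0,\infty)$ with $f(0)=0$; it is doubling if there is $r>0$ with $f(2t) < r f(t)$ for all $t>0$. For $A \subseteq X$ and $\delta\in(0,\infty]$, $\mathcal{H}^f_\delta(A) = \inf\{\sum_n f(\mathrm{diam}(C_n)) : A\subseteq \bigcup_n C_n,\ \mathrm{diam}(C_n)\le\delta\}$ and $\mathcal{H}^f(A)=\lim_{\delta\to 0}\mathcal{H}^f_\delta(A)$. $\mathcal{N}^f_X$ is the ideal of subsets of $X$ of $\mathcal{H}^f$-measure zero. $A_x = \{y : (x,y)\in A\}$. *)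

theory Defs
  imports "HOL-Analysis.Analysis"
begin

definition gauge_function :: "(real \<Rightarrow> real) \<Rightarrow> bool" where
  "gauge_function f \<longleftrightarrow>
     (\<forall>t\<ge>0. 0 \<le> f t) \<and> f 0 = 0 \<and> mono_on {0..} f \<and> (\<forall>t\<ge>0. continuous (at_right t) f)"

definition doubling :: "(real \<Rightarrow> real) \<Rightarrow> bool" where
  "doubling f \<longleftrightarrow> (\<exists>r>0. \<forall>t>0. f (2 * t) < r * f t)"

text \<open>The covering sets are required to be bounded because the library's \<open>diameter\<close> is
  unspecified on unbounded sets; in a bounded space \<open>X\<close> this is no restriction.
  If no admissible cover exists, the infimum is \<open>\<infinity>\<close>.\<close>

definition hausdorff_content ::
  "'a::metric_space set \<Rightarrow> (real \<Rightarrow> real) \<Rightarrow> ennreal \<Rightarrow> 'a set \<Rightarrow> ennreal" where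
  "hausdorff_content X f \<delta> A =
     Inf {(\<Sum>n. ennreal (f (diameter (C n)))) | C :: nat \<Rightarrow> 'a set.
            A \<subseteq> (\<Union>n. C n) \<and>
            (\<forall>n. C n \<subseteq> X \<and> bounded (C n) \<and> ennreal (diameter (C n)) \<le> \<delta>)}"

definition hausdorff_measure ::
  "'a::metric_space set \<Rightarrow> (real \<Rightarrow> real) \<Rightarrow> 'a set \<Rightarrow> ennreal" where
  "hausdorff_measure X f A = Lim (at_right 0) (\<lambda>\<delta>. hausdorff_content X f \<delta> A)"

lemma hausdorff_content_antimono:
  fixes X :: "'a::metric_space set"
  assumes "\<delta> \<le> \<epsilon>"
  shows "hausdorff_content X f \<epsilon> A \<le> hausdorff_content X f \<delta> A"
  unfolding hausdorff_content_def
proof (intro Inf_superset_mono subsetI)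
  fix s
  assume "s \<in> {(\<Sum>n. ennreal (f (diameter (C n)))) | C :: nat \<Rightarrow> 'a set.
            A \<subseteq> (\<Union>n. C n) \<and>
            (\<forall>n. C n \<subseteq> X \<and> bounded (C n) \<and> ennreal (diameter (C n)) \<le> \<delta>)}"
  then obtain C :: "nat \<Rightarrow> 'a set" where C: "s = (\<Sum>n. ennreal (f (diameter (C n))))"
    "A \<subseteq> (\<Union>n. C n)"
    "\<forall>n. C n \<subseteq> X \<and> bounded (C n) \<and> ennreal (diameter (C n)) \<le> \<delta>"
    by (elim CollectE exE conjE)
  from C(3) assms have "\<forall>n. C n \<subseteq> X \<and> bounded (C n) \<and> ennreal (diameter (C n)) \<le> \<epsilon>"
    by (meson order_trans)
  with C(1,2) show "s \<in> {(\<Sum>n. ennreal (f (diameter (C n)))) | C :: nat \<Rightarrow> 'a set.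
            A \<subseteq> (\<Union>n. C n) \<and>
            (\<forall>n. C n \<subseteq> X \<and> bounded (C n) \<and> ennreal (diameter (C n)) \<le> \<epsilon>)}"
    by (intro CollectI exI[of _ C] conjI)
qed

text \<open>The limit exists, so \<open>Lim\<close> is never applied to a divergent function.\<close>

lemma hausdorff_content_tendsto_SUP:
  "((\<lambda>\<delta>. hausdorff_content X f \<delta> A) \<longlongrightarrow> (SUP \<delta>\<in>{0<..}. hausdorff_content X f \<delta> A)) (at_right 0)"
proof (rule order_tendstoI)
  fix a assume "a < (SUP \<delta>\<in>{0<..}. hausdorff_content X f \<delta> A)"
  then obtain d where d: "0 < d" "a < hausdorff_content X f d A"
    unfolding less_SUP_iff by (meson greaterThan_iff)
  then have "a < hausdorff_content X f \<delta> A" if "\<delta> < d" for \<delta>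
    using that hausdorff_content_antimono[of \<delta> d X f A] by (meson less_imp_le less_le_trans)
  then show "eventually (\<lambda>\<delta>. a < hausdorff_content X f \<delta> A) (at_right 0)"
    using d(1) by (auto simp: eventually_at_right[OF d(1)])
next
  fix a assume a: "(SUP \<delta>\<in>{0<..}. hausdorff_content X f \<delta> A) < a"
  have "hausdorff_content X f \<delta> A < a" if "0 < \<delta>" for \<delta>
    using a that by (meson SUP_upper greaterThan_iff le_less_trans)
  then show "eventually (\<lambda>\<delta>. hausdorff_content X f \<delta> A < a) (at_right 0)"
    by (auto simp: eventually_at_filter)
qed

lemma hausdorff_measure_eq_SUP:
  "hausdorff_measure X f A = (SUP \<delta>\<in>{0<..}. hausdorff_content X f \<delta> A)"
proof -
  have "at_right (0::ennreal) \<noteq> bot"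
  proof
    assume "at_right (0::ennreal) = bot"
    then have "eventually (\<lambda>_. False) (at_right (0::ennreal))"
      by (simp only: eventually_bot)
    then obtain b :: ennreal where b: "0 < b" "\<forall>y>0. y < b \<longrightarrow> False"
      unfolding eventually_at_right[OF zero_less_one] by (elim exE conjE)
    obtain y where "0 < y" "y < b" using dense[OF b(1)] by (elim exE conjE)
    with b(2) show False by (elim allE impE)
  qed
  then show ?thesis
    unfolding hausdorff_measure_def by (rule tendsto_Lim[OF _ hausdorff_content_tendsto_SUP])
qed

text \<open>Boldface \<open>\<Sigma>\<^sup>1\<^sub>1\<close> subsets of a Polish space \<open>Y\<close>: projections of closed subsets of the product
  of \<open>Y\<close> with the Baire space (\<open>nat \<Rightarrow> nat\<close> with the product of the discrete topologies).\<close>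

definition Sigma11_in :: "'a::topological_space set \<Rightarrow> 'a set \<Rightarrow> bool" where
  "Sigma11_in Y A \<longleftrightarrow>
     (\<exists>C. closedin (top_of_set (Y \<times> (UNIV :: (nat \<Rightarrow> nat) set))) C \<and> A = fst ` C)"

end

theory Submission
  imports Defs
begin

text \<open>Write \<open>\<phi>\<close> for the content \<open>H\<^sup>f\<^sub>\<infinity>\<close>. Since doubling forces \<open>f > 0\<close> off \<open>0\<close>, the
  null sets of \<open>\<phi>\<close> and of the Hausdorff measure agree. The content is a Choquet capacity: it is
  continuous along decreasing sequences of compact sets, because \<open>f\<close> is continuous, and along
  arbitrary increasing sequences (Davies). Write the union of the sections as the projection of a
  closed set of triples \<open>(x, y, z)\<close>. If its content exceeds \<open>c > 0\<close>, then continuity along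
  increasing sequences yields, one coordinate at a time, a bound \<open>g\<close> such that restricting the
  first \<open>k\<close> coordinates of \<open>x\<close> and \<open>z\<close> to be at most \<open>g\<close> keeps the content above \<open>c\<close> for every
  \<open>k\<close>. Passing to closures and to the intersection over \<open>k\<close>, the \<open>y\<close> with witnesses \<open>x, z \<le> g\<close>
  still have content at least \<open>c\<close>; by monotonicity they all lie in the null section at \<open>g\<close>.\<close>

section \<open>Metric outer measures\<close>

lemma finite_Union_le_sum:
  fixes \<phi> :: "'a set \<Rightarrow> ennreal"
  assumes empty: "\<phi> {} = 0"
    and subadd: "\<And>A :: nat \<Rightarrow> 'a set. \<phi> (\<Union>n. A n) \<le> (\<Sum>n. \<phi> (A n))"
    and "finite I"
  shows "\<phi> (\<Union>i\<in>I. A i) \<le> (\<Sum>i\<in>I. \<phi> (A i))"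
proof -
  obtain h where h: "bij_betw h {..<card I} I"
    using bij_betw_from_nat_into_finite[OF \<open>finite I\<close>] by blast
  define B where "B n = (if n < card I then A (h n) else {})" for n
  have "i \<in> I \<longleftrightarrow> (\<exists>n<card I. i = h n)" for i
    using bij_betw_imp_surj_on[OF h] by (metis imageE imageI lessThan_iff)
  then have "(\<Union>i\<in>I. A i) = (\<Union>n. B n)"
    by (auto simp: B_def split: if_splits)
  also have "\<phi> \<dots> \<le> (\<Sum>n. \<phi> (B n))"
    by (rule subadd)
  also have "\<dots> = (\<Sum>n<card I. \<phi> (B n))"
    by (rule suminf_finite) (auto simp: B_def empty)
  also have "\<dots> = (\<Sum>n<card I. \<phi> (A (h n)))"
    by (simp add: B_def)
  also have "\<dots> = (\<Sum>i\<in>I. \<phi> (A i))"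
    by (rule sum.reindex_bij_betw[OF h])
  finally show ?thesis .
qed

lemma Un_le_add:
  fixes \<phi> :: "'a set \<Rightarrow> ennreal"
  assumes empty: "\<phi> {} = 0"
    and subadd: "\<And>A :: nat \<Rightarrow> 'a set. \<phi> (\<Union>n. A n) \<le> (\<Sum>n. \<phi> (A n))"
  shows "\<phi> (A \<union> B) \<le> \<phi> A + \<phi> B"
  using finite_Union_le_sum[OF assms, of UNIV "\<lambda>b. if b then A else B"]
  by (simp add: UNIV_bool Un_commute add.commute)

text \<open>With \<open>subadd\<close> and \<open>empty\<close>, the inequality
  \<open>separated\<close> makes the outer measure additive on sets at positive distance, which is
  what brings the closed sets into Caratheodory's sigma-algebra.\<close>

locale metric_outer_measure =
  fixes \<mu> :: "'a::metric_space set \<Rightarrow> ennreal"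
  assumes empty: "\<mu> {} = 0"
    and mono: "\<And>A B. A \<subseteq> B \<Longrightarrow> \<mu> A \<le> \<mu> B"
    and subadd: "\<And>A :: nat \<Rightarrow> 'a set. \<mu> (\<Union>n. A n) \<le> (\<Sum>n. \<mu> (A n))"
    and separated: "\<And>A B d. 0 < d \<Longrightarrow> (\<And>a b. a \<in> A \<Longrightarrow> b \<in> B \<Longrightarrow> d \<le> dist a b)
      \<Longrightarrow> \<mu> A + \<mu> B \<le> \<mu> (A \<union> B)"
begin

lemma outer_measure_space: "outer_measure_space (Pow UNIV) \<mu>"
  unfolding outer_measure_space_def positive_def increasing_def countably_subadditive_def
  using empty mono subadd by auto

text \<open>Between two distinct rings whose indices have the same parity lies a full ring of the
  other parity. Since \<open>g\<close> is 1-Lipschitz, this gap in its values is a gap in distance,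
  so \<open>separated\<close> applies at every step of an induction on the number of rings.\<close>

lemma ring_sums_le:
  fixes g :: "'a \<Rightarrow> real" and p :: nat and T :: "'a set"
  assumes g: "\<And>x y. g x \<le> g y + dist x y"
  defines "R \<equiv> \<lambda>n. {x \<in> T. 1 / (real n + 2) \<le> g x \<and> g x < 1 / (real n + 1)}"
  shows "(\<Sum>k<m. \<mu> (R (2 * k + p))) \<le> \<mu> T"
proof -
  have "(\<Sum>k<m. \<mu> (R (2 * k + p))) \<le> \<mu> (\<Union>k<m. R (2 * k + p))"
  proof (induction m)
    case (Suc m)
    define U where "U = (\<Union>k<m. R (2 * k + p))"
    have "\<mu> U + \<mu> (R (2 * m + p)) \<le> \<mu> (U \<union> R (2 * m + p))"
    \<comment> \<open>For \<open>m = 0\<close> and \<open>p = 0\<close> the bound below would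
      involve 1/0, which evaluates to 0; there \<open>U\<close> is empty anyway.\<close>
    proof (cases "m = 0")
      case True
      then show ?thesis by (simp add: U_def empty)
    next
      case False
      show ?thesis
      proof (rule separated)
        \<comment> \<open>The separation is the width of the skipped ring, the one of index
          \<open>2 * m + p - 1\<close>.\<close>
        show "0 < 1 / real (2 * m + p) - 1 / real (2 * m + p + 1)"
          using False by (simp add: divide_strict_left_mono)
        fix a b assume "a \<in> U" "b \<in> R (2 * m + p)"
        then obtain k where k: "k < m" "a \<in> R (2 * k + p)" by (auto simp: U_def)
        have "1 / real (2 * m + p) \<le> 1 / (real (2 * k + p) + 2)"
          using k(1) by (intro divide_left_mono) auto
        also have "\<dots> \<le> g a" using k(2) by (simp add: R_def)
        finally have "1 / real (2 * m + p) \<le> g a" .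
        moreover have "g b < 1 / real (2 * m + p + 1)"
          using \<open>b \<in> R (2 * m + p)\<close> by (simp add: R_def add.commute)
        ultimately show "1 / real (2 * m + p) - 1 / real (2 * m + p + 1) \<le> dist a b"
          using g[of a b] by linarith
      qed
    qed
    moreover have "U \<union> R (2 * m + p) = (\<Union>k<Suc m. R (2 * k + p))"
      by (simp add: U_def lessThan_Suc Un_commute)
    ultimately show ?case
      using Suc by (simp add: U_def) (meson add_right_mono order_trans)
  qed (simp add: empty)
  also have "\<dots> \<le> \<mu> T" by (rule mono) (auto simp: R_def)
  finally show ?thesis .
qed

text \<open>Caratheodory's criterion: \<open>T - S\<close> is exhausted by the parts of \<open>T\<close> at positive distance
  from \<open>S\<close>; every other one of the remaining rings is separated from the previous ones, so the
  measures of the rings are summable.\<close>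

lemma closed_in_lambda_system:
  assumes "closed S"
  shows "S \<in> lambda_system UNIV (Pow UNIV) \<mu>"
proof -
  have "\<mu> (T \<inter> S) + \<mu> (T - S) \<le> \<mu> T" for T
  \<comment> \<open>On the empty set \<open>infdist\<close> takes the default value 0, so distances
    carry no information there; finiteness of \<open>\<mu> T\<close> is what makes the ring sums
    summable.\<close>
  proof (cases "S = {} \<or> \<mu> T = top")
    case True
    then show ?thesis by (auto simp: empty)
  next
    case False
    then have S: "S \<noteq> {}" and T: "\<mu> T \<noteq> top" by auto
    let ?g = "\<lambda>x. infdist x S"
    define R where "R n = {x \<in> T. 1 / (real n + 2) \<le> ?g x \<and> ?g x < 1 / (real n + 1)}" for n
    define T' where "T' n = {x \<in> T. 1 / (real n + 1) \<le> ?g x}" for n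
    have ring: "(\<Sum>k<m. \<mu> (R (2 * k + p))) \<le> \<mu> T" for m p
      unfolding R_def by (rule ring_sums_le) (rule infdist_triangle)
    have partial: "(\<Sum>n<N. \<mu> (R n)) \<le> \<mu> T + \<mu> T" for N
    proof -
      have "(\<Sum>n<N. \<mu> (R n)) \<le> (\<Sum>n<2 * N. \<mu> (R n))"
        by (rule sum_mono2) auto
      also have "\<dots> = (\<Sum>k<N. \<mu> (R (2 * k + 0))) + (\<Sum>k<N. \<mu> (R (2 * k + 1)))"
        by (induction N) (auto simp: algebra_simps)
      also have "\<dots> \<le> \<mu> T + \<mu> T"
        by (intro add_mono ring)
      finally show ?thesis .
    qed
    then have suminf: "(\<Sum>n. \<mu> (R n)) \<le> \<mu> T + \<mu> T"
      by (intro suminf_le_const) auto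
    have fin: "(\<Sum>n. \<mu> (R n)) \<noteq> top"
      using suminf T by (metis ennreal_add_eq_top top.extremum_unique)
    have "\<mu> (R n) \<noteq> top" for n
      using T mono[of "R n" T] by (auto simp: R_def top_unique)
    moreover define r where "r n = enn2real (\<mu> (R n))" for n
    ultimately have r: "\<mu> (R n) = ennreal (r n)" "0 \<le> r n" for n
      by (simp_all add: less_top)
    have sr: "summable r"
      using fin r by (intro summable_suminf_not_top) auto
    show ?thesis
    proof (rule ennreal_le_epsilon)
      fix e :: real assume e: "0 < e"
      obtain n where "norm (\<Sum>i. r (i + n)) < e"
        using suminf_exist_split[OF e sr] by auto
      then have "(\<Sum>i. \<mu> (R (i + n))) \<le> ennreal e"
        using sr r by (simp add: suminf_ennreal2 ennreal_leI)
      have cover: "T - S \<subseteq> T' n \<union> (\<Union>i. R (i + n))"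
      proof
        fix x assume x: "x \<in> T - S"
        then have pos: "0 < ?g x"
          using in_closed_iff_infdist_zero[OF \<open>closed S\<close> S, of x] infdist_nonneg[of x S] by auto
        show "x \<in> T' n \<union> (\<Union>i. R (i + n))"
        proof (cases "x \<in> T' n")
          case False
          then have lt: "?g x < 1 / (real n + 1)" using x by (auto simp: T'_def)
          obtain N where N: "1 / (real N + 2) \<le> ?g x"
          proof -
            obtain N where "1 / real (Suc N) < ?g x" using nat_approx_posE[OF pos] by auto
            moreover have "1 / (real N + 2) \<le> 1 / real (Suc N)"
              by (intro divide_left_mono) auto
            ultimately show ?thesis using that[of N] by linarith
          qed
          \<comment> \<open>The least index gives the lower bound of ring \<open>k\<close>, and
            minimality the upper one. At \<open>k = n\<close> there need be no failing predecessor
            in range; there the upper bound is that \<open>x\<close> lies outside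
            \<open>T' n\<close>.\<close>
          define k where "k = (LEAST k. 1 / (real k + 2) \<le> ?g x)"
          have k1: "1 / (real k + 2) \<le> ?g x"
            unfolding k_def using N by (rule LeastI)
          have kn: "n \<le> k"
          proof (rule ccontr)
            assume "\<not> n \<le> k"
            then have "1 / (real n + 1) \<le> 1 / (real k + 2)"
              by (intro divide_left_mono) auto
            then show False using k1 lt by linarith
          qed
          have k2: "?g x < 1 / (real k + 1)"
          proof (cases "k = n")
            case False
            then obtain j where j: "k = Suc j" using kn by (cases k) auto
            have "\<not> 1 / (real j + 2) \<le> ?g x"
              unfolding not_less_Least using j
              by (metis k_def lessI not_less_Least)
            then show ?thesis using j by (simp add: add.commute)
          qed (use lt in simp)
          have "x \<in> R ((k - n) + n)" using k1 k2 kn x by (simp add: R_def)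
          then show ?thesis by blast
        qed simp
      qed
      have "\<mu> (T - S) \<le> \<mu> (T' n) + \<mu> (\<Union>i. R (i + n))"
        using mono[OF cover] Un_le_add[OF empty subadd] order_trans by blast
      also have "\<dots> \<le> \<mu> (T' n) + ennreal e"
        using subadd[of "\<lambda>i. R (i + n)"] \<open>(\<Sum>i. \<mu> (R (i + n))) \<le> ennreal e\<close>
        by (intro add_left_mono) simp
      finally have "\<mu> (T \<inter> S) + \<mu> (T - S) \<le> \<mu> (T \<inter> S) + \<mu> (T' n) + ennreal e"
        by (simp add: add.assoc add_left_mono)
      also have "\<mu> (T \<inter> S) + \<mu> (T' n) \<le> \<mu> ((T \<inter> S) \<union> T' n)"
      proof (rule separated)
        show "0 < 1 / (real n + 1)" by simp
        fix a b assume "a \<in> T \<inter> S" "b \<in> T' n"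
        then show "1 / (real n + 1) \<le> dist a b"
          using infdist_le[of a S b] by (simp add: T'_def dist_commute)
      qed
      also have "\<dots> \<le> \<mu> T" by (rule mono) (auto simp: T'_def)
      finally show "\<mu> (T \<inter> S) + \<mu> (T - S) \<le> \<mu> T + ennreal e"
        by (simp add: add_right_mono)
    qed
  qed
  moreover have "\<mu> T \<le> \<mu> (T \<inter> S) + \<mu> (T - S)" for T
    using Un_le_add[OF empty subadd, of "T \<inter> S" "T - S"] by (simp add: Int_Diff_Un)
  ultimately show ?thesis
    unfolding algebra.lambda_system_eq[OF algebra_Pow] by (simp add: order_antisym)
qed

text \<open>The sets \<open>F n\<close> need not be measurable, so they are replaced by Borel hulls.
  Intersecting all hulls from index \<open>n\<close> on makes the hulls increase; they still contain
  \<open>F n\<close>, because \<open>F\<close> increases, and are no larger than the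
  \<open>n\<close>-th hull. Continuity from below on the Caratheodory sigma-algebra then
  applies.\<close>

lemma UN_incseq_le:
  assumes hull: "\<And>n. \<exists>G\<in>sets borel. F n \<subseteq> G \<and> \<mu> G \<le> \<mu> (F n)"
    and inc: "incseq F" and bound: "\<And>n. \<mu> (F n) \<le> b"
  shows "\<mu> (\<Union>n. F n) \<le> b"
proof -
  let ?L = "lambda_system UNIV (Pow UNIV) \<mu>"
  have ms: "measure_space UNIV ?L \<mu>"
    using sigma_algebra.caratheodory_lemma[OF sigma_algebra_Pow outer_measure_space] .
  then have sa: "sigma_algebra UNIV ?L" by (simp add: measure_space_def)
  define M where "M = measure_of UNIV ?L \<mu>"
  have sets: "sets M = ?L"
    unfolding M_def
    by (rule trans[OF sets_measure_of sigma_algebra.sigma_sets_eq[OF sa]]) simp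
  have em: "emeasure M A = \<mu> A" if "A \<in> ?L" for A
    unfolding M_def using ms that
    by (intro emeasure_measure_of_sigma sa) (auto simp: measure_space_def)
  have "sets borel \<subseteq> ?L"
  proof -
    have "sets (borel :: 'a measure) = sigma_sets UNIV (Collect closed)"
      unfolding borel_eq_closed by (rule sets_measure_of) simp
    also have "\<dots> \<subseteq> ?L"
      by (rule sigma_algebra.sigma_sets_subset[OF sa]) (use closed_in_lambda_system in auto)
    finally show ?thesis .
  qed
  obtain G where G: "\<And>n. G n \<in> sets borel" "\<And>n. F n \<subseteq> G n" "\<And>n. \<mu> (G n) \<le> \<mu> (F n)"
    using hull by metis
  define G' where "G' n = (\<Inter>j\<in>{n..}. G j)" for n
  have G': "G' n \<in> sets M" for n
    unfolding sets G'_def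
    by (rule subsetD[OF \<open>sets borel \<subseteq> ?L\<close>]) (auto intro!: sets.countable_INT'' G)
  have "incseq G'" unfolding G'_def by (intro incseq_SucI) auto
  have F: "F n \<subseteq> G' n" for n
    using G(2) incseqD[OF inc] unfolding G'_def by (meson INT_greatest atLeast_iff subset_trans)
  have "\<mu> (\<Union>n. F n) \<le> \<mu> (\<Union>n. G' n)" using F by (intro mono) blast
  also have "\<dots> = emeasure M (\<Union>n. G' n)"
    using G' sets by (intro em[symmetric]) (metis sets.countable_UN image_subset_iff)
  also have "\<dots> = (SUP n. emeasure M (G' n))"
    using G' \<open>incseq G'\<close> by (intro SUP_emeasure_incseq[symmetric]) auto
  also have "\<dots> \<le> b"
  proof (rule SUP_least)
    fix n
    have "emeasure M (G' n) = \<mu> (G' n)" using G' sets by (intro em) auto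
    also have "\<dots> \<le> \<mu> (G n)" by (intro mono) (auto simp: G'_def)
    also have "\<dots> \<le> b" using G(3) bound order_trans by blast
    finally show "emeasure M (G' n) \<le> b" .
  qed
  finally show ?thesis .
qed

end

section \<open>Hausdorff content and measure\<close>

lemma ennreal_less_add_pos:
  fixes x :: ennreal
  assumes "x < top" "0 < e"
  shows "x < x + ennreal e"
  using assms by (cases x) (auto simp: ennreal_less_iff simp flip: ennreal_plus)

lemma ennreal_pos_lower_boundE:
  fixes x :: ennreal
  assumes "0 < x"
  obtains r where "0 < r" "ennreal r \<le> x"
proof (cases x)
  case (real r)
  with assms show ?thesis using that[of r] by (simp add: ennreal_less_zero_iff)
next
  case top
  then show ?thesis using that[of 1] by simp
qed

section \<open>Monotonicity and countable subadditivity of content and measure\<close>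

lemma hausdorff_content_le:
  assumes "bounded X" "A \<subseteq> (\<Union>n. C n)" "\<And>n. C n \<subseteq> X" "\<And>n. ennreal (diameter (C n)) \<le> \<delta>"
  shows "hausdorff_content X f \<delta> A \<le> (\<Sum>n. ennreal (f (diameter (C n))))"
  unfolding hausdorff_content_def
  using assms bounded_subset[OF \<open>bounded X\<close>] by (intro Inf_lower) blast

lemma hausdorff_content_lessE:
  assumes "hausdorff_content X f \<delta> A < a"
  obtains C :: "nat \<Rightarrow> 'a::metric_space set" where
    "A \<subseteq> (\<Union>n. C n)" "\<And>n. C n \<subseteq> X" "\<And>n. bounded (C n)" "\<And>n. ennreal (diameter (C n)) \<le> \<delta>"
    "(\<Sum>n. ennreal (f (diameter (C n)))) < a"
  using assms unfolding hausdorff_content_def Inf_less_iff by blast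

lemma hausdorff_content_mono:
  assumes "A \<subseteq> B"
  shows "hausdorff_content X f \<delta> A \<le> hausdorff_content X f \<delta> B"
  unfolding hausdorff_content_def using assms by (intro Inf_superset_mono) blast

lemma hausdorff_content_le_measure:
  assumes "0 < \<delta>"
  shows "hausdorff_content X f \<delta> A \<le> hausdorff_measure X f A"
  unfolding hausdorff_measure_eq_SUP using assms by (intro SUP_upper) auto

lemma hausdorff_measure_le:
  assumes "\<And>\<delta>. 0 < \<delta> \<Longrightarrow> hausdorff_content X f \<delta> A \<le> b"
  shows "hausdorff_measure X f A \<le> b"
  unfolding hausdorff_measure_eq_SUP using assms by (intro SUP_least) auto

lemma hausdorff_measure_mono:
  assumes "A \<subseteq> B"
  shows "hausdorff_measure X f A \<le> hausdorff_measure X f B"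
  by (meson assms hausdorff_content_le_measure hausdorff_content_mono hausdorff_measure_le
      order_trans)

lemma hausdorff_content_subadd:
  fixes A :: "nat \<Rightarrow> 'a::metric_space set"
  assumes "bounded X"
  shows "hausdorff_content X f \<delta> (\<Union>n. A n) \<le> (\<Sum>n. hausdorff_content X f \<delta> (A n))"
proof (rule ennreal_le_epsilon)
  let ?H = "hausdorff_content X f \<delta>"
  fix e :: real assume fin: "(\<Sum>n. ?H (A n)) < top" and e: "0 < e"
  have "\<exists>C :: nat \<Rightarrow> 'a set. A n \<subseteq> (\<Union>m. C m) \<and> (\<forall>m. C m \<subseteq> X) \<and>
      (\<forall>m. ennreal (diameter (C m)) \<le> \<delta>) \<and>
      (\<Sum>m. ennreal (f (diameter (C m)))) < ?H (A n) + ennreal (e * (1/2) ^ Suc n)" for n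
  proof -
    have "?H (A n) < top" using ennreal_suminf_lessD[OF fin] .
    then have "?H (A n) < ?H (A n) + ennreal (e * (1/2) ^ Suc n)"
      using e by (intro ennreal_less_add_pos) auto
    then show ?thesis by (rule hausdorff_content_lessE) blast
  qed
  then obtain C :: "nat \<Rightarrow> nat \<Rightarrow> 'a set" where C: "\<And>n. A n \<subseteq> (\<Union>m. C n m)" "\<And>n m. C n m \<subseteq> X"
      "\<And>n m. ennreal (diameter (C n m)) \<le> \<delta>"
      "\<And>n. (\<Sum>m. ennreal (f (diameter (C n m)))) < ?H (A n) + ennreal (e * (1/2) ^ Suc n)"
    by metis
  define D where "D = (\<lambda>(n, m). C n m)"
  have "?H (\<Union>n. A n) \<le> (\<Sum>i. ennreal (f (diameter (D (prod_decode i)))))"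
  proof (rule hausdorff_content_le[OF assms])
    show "(\<Union>n. A n) \<subseteq> (\<Union>i. D (prod_decode i))"
    proof safe
      fix x n assume "x \<in> A n"
      then obtain m where "x \<in> C n m" using C(1) by blast
      then have "x \<in> D (prod_decode (prod_encode (n, m)))" by (simp add: D_def)
      then show "x \<in> (\<Union>i. D (prod_decode i))" by blast
    qed
  qed (auto simp: D_def C(3) split: prod.split dest: subsetD[OF C(2)])
  also have "\<dots> = (\<Sum>n. \<Sum>m. ennreal (f (diameter (D (n, m)))))"
    by (rule suminf_ennreal_2dimen) simp
  also have "\<dots> \<le> (\<Sum>n. ?H (A n) + ennreal (e * (1/2) ^ Suc n))"
    using C(4) by (intro suminf_le) (auto simp: D_def intro: less_imp_le)
  also have "\<dots> = (\<Sum>n. ?H (A n)) + (\<Sum>n. ennreal (e * (1/2) ^ Suc n))"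
    by (rule suminf_add[symmetric]) auto
  also have "(\<Sum>n. ennreal (e * (1/2) ^ Suc n)) = ennreal e"
    using e sums_mult[OF power_half_series, of e] by (intro sums_unique[symmetric] sums_ennreal[THEN iffD2]) auto
  finally show "?H (\<Union>n. A n) \<le> (\<Sum>n. ?H (A n)) + ennreal e" .
qed

lemma hausdorff_measure_subadd:
  fixes A :: "nat \<Rightarrow> 'a::metric_space set"
  assumes "bounded X"
  shows "hausdorff_measure X f (\<Union>n. A n) \<le> (\<Sum>n. hausdorff_measure X f (A n))"
proof (rule hausdorff_measure_le)
  fix \<delta> :: ennreal assume "0 < \<delta>"
  have "hausdorff_content X f \<delta> (\<Union>n. A n) \<le> (\<Sum>n. hausdorff_content X f \<delta> (A n))"
    by (rule hausdorff_content_subadd[OF assms])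
  also have "\<dots> \<le> (\<Sum>n. hausdorff_measure X f (A n))"
    using \<open>0 < \<delta>\<close> by (intro suminf_le hausdorff_content_le_measure) auto
  finally show "hausdorff_content X f \<delta> (\<Union>n. A n) \<le> (\<Sum>n. hausdorff_measure X f (A n))" .
qed

lemma hausdorff_content_empty:
  fixes X :: "'a::metric_space set"
  assumes "f 0 = 0"
  shows "hausdorff_content X f \<delta> {} = 0"
proof -
  have "hausdorff_content X f \<delta> {} \<le> (\<Sum>n. ennreal (f (diameter ({} :: 'a set))))"
    unfolding hausdorff_content_def by (intro Inf_lower CollectI exI[of _ "\<lambda>_. {}"]) auto
  then show ?thesis using assms by simp
qed

lemma hausdorff_measure_empty:
  assumes "f 0 = 0"
  shows "hausdorff_measure X f {} = 0"
proof -
  have "hausdorff_measure X f {} \<le> 0"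
    by (rule hausdorff_measure_le) (simp add: hausdorff_content_empty[of f, OF assms])
  then show ?thesis by simp
qed

text \<open>At a scale below \<open>d\<close> no covering set meets both \<open>A\<close> and
  \<open>B\<close>, so every cover of the union splits into a cover of each with no set used
  twice.\<close>

lemma hausdorff_content_separated:
  fixes A B X :: "'a::metric_space set"
  assumes X: "bounded X" and f: "f 0 = 0"
    and sep: "\<And>a b. a \<in> A \<Longrightarrow> b \<in> B \<Longrightarrow> d \<le> dist a b" and \<delta>: "\<delta> < ennreal d"
  shows "hausdorff_content X f \<delta> A + hausdorff_content X f \<delta> B \<le> hausdorff_content X f \<delta> (A \<union> B)"
    (is "?H A + ?H B \<le> _")
  unfolding hausdorff_content_def[of X f \<delta> "A \<union> B"]
proof (rule Inf_greatest, elim CollectE exE conjE)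
  fix s and C :: "nat \<Rightarrow> 'a set"
  assume s: "s = (\<Sum>n. ennreal (f (diameter (C n))))" and cover: "A \<union> B \<subseteq> (\<Union>n. C n)"
    and C: "\<forall>n. C n \<subseteq> X \<and> bounded (C n) \<and> ennreal (diameter (C n)) \<le> \<delta>"
  \<comment> \<open>Sets missing \<open>S\<close> are replaced by the empty set instead of being
    dropped. This keeps the index set, at cost \<open>f 0 = 0\<close>.\<close>
  define P where "P S n = (if C n \<inter> S = {} then {} else C n)" for S n
  have H: "?H S \<le> (\<Sum>n. ennreal (f (diameter (P S n))))" if sub: "S \<subseteq> A \<union> B" for S
  proof (rule hausdorff_content_le[OF X])
    show "S \<subseteq> (\<Union>n. P S n)"
    proof
      fix x assume "x \<in> S"
      then obtain n where "x \<in> C n" using sub cover by blast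
      then have "x \<in> P S n" using \<open>x \<in> S\<close> by (auto simp: P_def)
      then show "x \<in> (\<Union>n. P S n)" by blast
    qed
  qed (use C in \<open>auto simp: P_def\<close>)
  have "?H A + ?H B \<le> (\<Sum>n. ennreal (f (diameter (P A n)))) + (\<Sum>n. ennreal (f (diameter (P B n))))"
    by (intro add_mono H) auto
  also have "\<dots> = (\<Sum>n. ennreal (f (diameter (P A n))) + ennreal (f (diameter (P B n))))"
    by (rule suminf_add) auto
  also have "\<dots> \<le> s"
    unfolding s
  proof (rule suminf_le)
    fix n
    have "C n \<inter> A = {} \<or> C n \<inter> B = {}"
    proof (rule ccontr)
      assume "\<not> ?thesis"
      then obtain a b where ab: "a \<in> C n" "a \<in> A" "b \<in> C n" "b \<in> B" by blast
      have "d \<le> diameter (C n)"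
        using sep[OF ab(2,4)] C ab diameter_bounded_bound[of "C n" a b] by force
      then have "ennreal d \<le> \<delta>" using C ennreal_leI order_trans by blast
      then show False using \<delta> by simp
    qed
    then show "ennreal (f (diameter (P A n))) + ennreal (f (diameter (P B n))) \<le> ennreal (f (diameter (C n)))"
      by (auto simp: P_def f)
  qed auto
  finally show "?H A + ?H B \<le> s" .
qed

lemma hausdorff_measure_separated:
  fixes A B X :: "'a::metric_space set"
  assumes X: "bounded X" and f: "f 0 = 0" and d: "0 < d"
    and sep: "\<And>a b. a \<in> A \<Longrightarrow> b \<in> B \<Longrightarrow> d \<le> dist a b"
  shows "hausdorff_measure X f A + hausdorff_measure X f B \<le> hausdorff_measure X f (A \<union> B)"
proof -
  let ?H = "hausdorff_content X f" and ?\<mu> = "hausdorff_measure X f"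
  have dir: "?H \<delta> A + ?H \<epsilon> B \<le> ?\<mu> (A \<union> B)" if pos: "0 < \<delta>" "0 < \<epsilon>" for \<delta> \<epsilon>
  proof -
    \<comment> \<open>A common scale, strictly below \<open>d\<close> and at most both given scales;
      contents only grow on passing to it.\<close>
    define \<eta> where "\<eta> = min (ennreal (d / 2)) (min \<delta> \<epsilon>)"
    have "0 < \<eta>" using pos d by (simp add: \<eta>_def)
    have "\<eta> \<le> ennreal (d / 2)" by (simp add: \<eta>_def)
    also have "\<dots> < ennreal d" using d by (intro ennreal_lessI) auto
    finally have "\<eta> < ennreal d" .
    have "?H \<delta> A + ?H \<epsilon> B \<le> ?H \<eta> A + ?H \<eta> B"
      by (intro add_mono hausdorff_content_antimono) (simp_all add: \<eta>_def min.coboundedI2)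
    also have "\<dots> \<le> ?H \<eta> (A \<union> B)"
      by (rule hausdorff_content_separated[where d = d]) (use X f sep \<open>\<eta> < ennreal d\<close> in auto)
    also have "\<dots> \<le> ?\<mu> (A \<union> B)"
      using \<open>0 < \<eta>\<close> by (rule hausdorff_content_le_measure)
    finally show ?thesis .
  qed
  have ne: "{0 :: ennreal <..} \<noteq> {}" using ennreal_zero_less_top by blast
  have "?\<mu> A + ?\<mu> B = (SUP \<delta>\<in>{0<..}. ?H \<delta> A + ?\<mu> B)"
    unfolding hausdorff_measure_eq_SUP[of X f A] by (rule ennreal_SUP_add_left[symmetric, OF ne])
  also have "\<dots> = (SUP \<delta>\<in>{0<..}. SUP \<epsilon>\<in>{0<..}. ?H \<delta> A + ?H \<epsilon> B)"
    unfolding hausdorff_measure_eq_SUP[of X f B] by (simp only: ennreal_SUP_add_right[OF ne])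
  also have "\<dots> \<le> ?\<mu> (A \<union> B)"
    using dir by (intro SUP_least) auto
  finally show ?thesis .
qed

lemma metric_outer_measure_hausdorff:
  assumes "bounded X" "f 0 = 0"
  shows "metric_outer_measure (hausdorff_measure X f)"
  using assms by unfold_locales
    (auto intro: hausdorff_measure_empty hausdorff_measure_mono hausdorff_measure_subadd
      hausdorff_measure_separated)

text \<open>Closing a bounded set keeps its diameter, and the closures stay in \<open>X\<close>
  because \<open>X\<close> is closed. So near-optimal covers at scales tending to 0 may be taken
  closed, and the intersection of their unions is a Borel set covered equally cheaply at every
  scale.\<close>

lemma hausdorff_measure_borel_hull:
  fixes A X :: "'a::metric_space set"
  assumes X: "bounded X" "closed X"
  shows "\<exists>G\<in>sets borel. A \<subseteq> G \<and> hausdorff_measure X f G \<le> hausdorff_measure X f A"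
proof (cases "hausdorff_measure X f A = top")
  case True
  then show ?thesis by (intro bexI[of _ UNIV]) auto
next
  case False
  let ?\<mu> = "hausdorff_measure X f"
  define e where "e n = 1 / real (Suc n)" for n
  have e: "0 < e n" for n by (simp add: e_def)
  have "\<exists>C :: nat \<Rightarrow> 'a set. A \<subseteq> (\<Union>m. C m) \<and> (\<forall>m. C m \<subseteq> X \<and> bounded (C m)) \<and>
      (\<forall>m. ennreal (diameter (C m)) \<le> ennreal (e n)) \<and>
      (\<Sum>m. ennreal (f (diameter (C m)))) < ?\<mu> A + ennreal (e n)" for n
  proof -
    have "hausdorff_content X f (ennreal (e n)) A \<le> ?\<mu> A"
      using e by (intro hausdorff_content_le_measure) simp
    also have "\<dots> < ?\<mu> A + ennreal (e n)"
      using False e by (intro ennreal_less_add_pos) (auto simp: less_top)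
    finally show ?thesis by (rule hausdorff_content_lessE) blast
  qed
  then obtain C :: "nat \<Rightarrow> nat \<Rightarrow> 'a set" where C: "\<And>n. A \<subseteq> (\<Union>m. C n m)"
      "\<And>n m. C n m \<subseteq> X" "\<And>n m. bounded (C n m)"
      "\<And>n m. ennreal (diameter (C n m)) \<le> ennreal (e n)"
      "\<And>n. (\<Sum>m. ennreal (f (diameter (C n m)))) < ?\<mu> A + ennreal (e n)"
    by metis
  define G where "G = (\<Inter>n. \<Union>m. closure (C n m))"
  have "G \<in> sets borel" unfolding G_def by auto
  moreover have "A \<subseteq> G" unfolding G_def
  proof (intro subsetI INT_I)
    fix x n assume "x \<in> A"
    then obtain m where "x \<in> C n m" using C(1) by blast
    then have "x \<in> closure (C n m)" using closure_subset by (rule subsetD[rotated])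
    then show "x \<in> (\<Union>m. closure (C n m))" by blast
  qed
  moreover have "?\<mu> G \<le> ?\<mu> A"
  proof (rule hausdorff_measure_le, rule ennreal_le_epsilon)
    fix \<delta> :: ennreal and d :: real assume "0 < \<delta>" "0 < d"
    obtain \<delta>' where \<delta>': "0 < \<delta>'" "ennreal \<delta>' \<le> \<delta>"
      using \<open>0 < \<delta>\<close> by (rule ennreal_pos_lower_boundE)
    \<comment> \<open>The number \<open>e n\<close> is both the scale of the \<open>n\<close>-th
      cover and its excess cost, so it has to lie below both tolerances.\<close>
    obtain n where n: "e n < min \<delta>' d"
      using nat_approx_posE[of "min \<delta>' d"] \<delta>'(1) \<open>0 < d\<close> unfolding e_def by auto
    have "hausdorff_content X f \<delta> G \<le> (\<Sum>m. ennreal (f (diameter (closure (C n m)))))"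
    proof (rule hausdorff_content_le[OF X(1)])
      fix m
      show "closure (C n m) \<subseteq> X" using C(2) X(2) by (rule closure_minimal)
      have "ennreal (diameter (closure (C n m))) \<le> ennreal (e n)"
        using C(3,4) by (simp add: diameter_closure)
      also have "\<dots> \<le> ennreal \<delta>'" using n by (intro ennreal_leI) auto
      finally show "ennreal (diameter (closure (C n m))) \<le> \<delta>" using \<delta>'(2) by simp
    qed (auto simp: G_def)
    also have "\<dots> = (\<Sum>m. ennreal (f (diameter (C n m))))"
      using C(3) by (simp add: diameter_closure)
    also have "\<dots> \<le> ?\<mu> A + ennreal (e n)" using C(5) by (rule less_imp_le)
    also have "\<dots> \<le> ?\<mu> A + ennreal d" using n by (intro add_left_mono ennreal_leI) auto
    finally show "hausdorff_content X f \<delta> G \<le> ?\<mu> A + ennreal d" .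
  qed
  ultimately show ?thesis by blast
qed

lemma hausdorff_measure_UN_incseq_le:
  assumes "bounded X" "closed X" "f 0 = 0"
    and "incseq F" "\<And>n. hausdorff_measure X f (F n) \<le> b"
  shows "hausdorff_measure X f (\<Union>n. F n) \<le> b"
  using metric_outer_measure.UN_incseq_le[OF metric_outer_measure_hausdorff]
    hausdorff_measure_borel_hull assms by blast

section \<open>Capacitability\<close>

lemma diameter_thickening_le:
  fixes U C :: "'a::metric_space set"
  assumes "bounded C" "0 \<le> \<rho>" and near: "\<And>u. u \<in> U \<Longrightarrow> \<exists>c\<in>C. dist u c \<le> \<rho>"
  shows "diameter U \<le> diameter C + 2 * \<rho>"
proof (cases "U = {}")
  case True
  then show ?thesis using assms by (simp add: diameter_ge_0)
next
  case False
  have "dist u v \<le> diameter C + 2 * \<rho>" if uv: "u \<in> U" "v \<in> U" for u v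
  proof -
    obtain c d where c: "c \<in> C" "dist u c \<le> \<rho>" and d: "d \<in> C" "dist v d \<le> \<rho>"
      using near uv by meson
    have "dist c d \<le> diameter C"
      using assms(1) c d by (intro diameter_bounded_bound)
    moreover have "dist u v \<le> dist u c + dist c d + dist v d"
      using dist_triangle[of u v c] dist_triangle[of c v d] by (simp add: dist_commute)
    ultimately show ?thesis using c(2) d(2) by linarith
  qed
  then show ?thesis using False unfolding diameter_def[of U] by (auto intro!: cSUP_least)
qed

text \<open>Iterated pigeonhole: in a decreasing chain of infinite index sets, the step from
  \<open>S K\<close> to \<open>S (Suc K)\<close> freezes coordinate \<open>K\<close>. It serves as
  sequential compactness twice, for finite families of net sets and for bounded points of Baire
  space.\<close>

lemma finite_range_cluster:
  fixes v :: "nat \<Rightarrow> nat \<Rightarrow> 'b"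
  assumes "\<And>k. finite (range (\<lambda>n. v n k))"
  shows "\<exists>w. \<forall>K m. \<exists>n\<ge>m. \<forall>k<K. v n k = w k"
proof -
  have "\<exists>S. \<forall>K. infinite (S K) \<and> (S (Suc K) \<subseteq> S K \<and> (\<exists>c. \<forall>n\<in>S (Suc K). v n K = c))"
  proof (rule dependent_nat_choice)
    show "\<exists>S :: nat set. infinite S" by (rule exI[of _ UNIV]) simp
  next
    fix S :: "nat set" and K assume "infinite S"
    moreover have "finite ((\<lambda>n. v n K) ` S)" by (rule finite_subset[OF image_mono[OF subset_UNIV] assms])
    ultimately obtain n0 where "infinite {n \<in> S. v n K = v n0 K}"
      using pigeonhole_infinite by blast
    then show "\<exists>S'. infinite S' \<and> (S' \<subseteq> S \<and> (\<exists>c. \<forall>n\<in>S'. v n K = c))"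
      by (intro exI[of _ "{n \<in> S. v n K = v n0 K}"]) auto
  qed
  then obtain S w where S: "\<And>K. infinite (S K)" "\<And>K. S (Suc K) \<subseteq> S K"
      "\<And>K n. n \<in> S (Suc K) \<Longrightarrow> v n K = w K"
    by metis
  have "\<exists>n\<ge>m. \<forall>k<K. v n k = w k" for K m
  proof -
    obtain n where n: "n \<ge> m" "n \<in> S K"
      using S(1)[of K] unfolding infinite_nat_iff_unbounded_le by blast
    have "v n k = w k" if "k < K" for k
    proof (rule S(3))
      have "S K \<subseteq> S (Suc k)" by (rule lift_Suc_antimono_le[of S, OF S(2)]) (use that in simp)
      then show "n \<in> S (Suc k)" using n by blast
    qed
    then show ?thesis using n by blast
  qed
  then show ?thesis by blast
qed

lemma tendsto_componentwise_fun:
  fixes f :: "'c \<Rightarrow> 'i \<Rightarrow> 'b::topological_space"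
  assumes "\<And>i. ((\<lambda>c. f c i) \<longlongrightarrow> l i) F"
  shows "(f \<longlongrightarrow> l) F"
proof -
  have "limitin (product_topology (\<lambda>_. euclidean) UNIV) f l F"
    unfolding limitin_componentwise using assms by simp
  then show ?thesis by (simp add: euclidean_product_topology)
qed

section \<open>Gauge values of thickened sets in a compact space\<close>

locale compact_gauge =
  fixes X :: "'a::metric_space set" and f :: "real \<Rightarrow> real"
  assumes X: "compact X" and f0: "f 0 = 0"
    and f_mono: "\<And>s t. 0 \<le> s \<Longrightarrow> s \<le> t \<Longrightarrow> f s \<le> f t"
    and f_pos: "\<And>t. 0 < t \<Longrightarrow> 0 < f t"
    and f_cont: "continuous_on {0..} f"
begin

lemma bounded_X: "bounded X" and closed_X: "closed X"
  using X by (auto simp: compact_imp_bounded compact_imp_closed)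

lemma bounded_sub: "C \<subseteq> X \<Longrightarrow> bounded C"
  using bounded_X bounded_subset by blast

lemma f_nonneg: "0 \<le> t \<Longrightarrow> 0 \<le> f t"
  using f_mono[of 0 t] f0 by simp

lemma f_diameter_nonneg: "C \<subseteq> X \<Longrightarrow> 0 \<le> f (diameter C)"
  by (intro f_nonneg diameter_ge_0 bounded_sub)

text \<open>All diameters involved lie in one compact interval, where \<open>f\<close> is uniformly
  continuous; hence a single radius works for all sets \<open>C\<close> at once.\<close>

lemma thickening:
  assumes "0 < e"
  obtains \<rho> where "0 < \<rho>"
    "\<And>C U. C \<subseteq> X \<Longrightarrow> U \<subseteq> X \<Longrightarrow> (\<And>u. u \<in> U \<Longrightarrow> \<exists>c\<in>C. dist u c \<le> \<rho>)
      \<Longrightarrow> f (diameter U) \<le> f (diameter C) + e"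
proof -
  have "uniformly_continuous_on {0..diameter X + 1} f"
    by (rule compact_uniformly_continuous) (auto intro: continuous_on_subset[OF f_cont])
  then obtain d where d: "0 < d" "\<And>s t. s \<in> {0..diameter X + 1} \<Longrightarrow> t \<in> {0..diameter X + 1} \<Longrightarrow>
      dist t s < d \<Longrightarrow> dist (f t) (f s) < e"
    using assms unfolding uniformly_continuous_on_def by metis
  \<comment> \<open>The diameter grows by at most \<open>2 * \<rho>\<close>, which is below
    \<open>d\<close> and at most 1/2, so the argument of \<open>f\<close> stays within the interval
    ending at \<open>diameter X + 1\<close>.\<close>
  define \<rho> where "\<rho> = min 1 d / 4"
  show ?thesis
  proof (rule that)
    show "0 < \<rho>" using d by (simp add: \<rho>_def)
    fix C U assume C: "C \<subseteq> X" and U: "U \<subseteq> X" and near: "\<And>u. u \<in> U \<Longrightarrow> \<exists>c\<in>C. dist u c \<le> \<rho>"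
    have "0 \<le> diameter U" "0 \<le> diameter C" "diameter C \<le> diameter X"
      using C U bounded_sub bounded_X by (auto intro: diameter_ge_0 diameter_subset)
    have "f (diameter U) \<le> f (diameter C + 2 * \<rho>)"
      using diameter_thickening_le[OF bounded_sub[OF C] _ near] \<open>0 < \<rho>\<close> \<open>0 \<le> diameter U\<close>
      by (intro f_mono) auto
    also have "dist (f (diameter C + 2 * \<rho>)) (f (diameter C)) < e"
      using \<open>0 \<le> diameter C\<close> \<open>diameter C \<le> diameter X\<close> \<open>0 < d\<close>
      by (intro d(2)) (auto simp: \<rho>_def dist_real_def min_def)
    then have "f (diameter C + 2 * \<rho>) \<le> f (diameter C) + e"
      by (simp add: dist_real_def abs_less_iff)
    finally show "f (diameter U) \<le> f (diameter C) + e" .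
  qed
qed

text \<open>The candidates are the unions, cut down to \<open>X\<close>, of balls around the points
  of a finite net. For a given \<open>C\<close> the balls that meet it are taken: they cover
  \<open>C\<close>, and their points are close to \<open>C\<close>. Rounding to finitely many sets
  is what lets a sequence of covers stabilise.\<close>

lemma finite_net:
  assumes "0 < e"
  obtains \<U> where "finite \<U>" "\<And>U. U \<in> \<U> \<Longrightarrow> U \<subseteq> X"
    "\<And>C. C \<subseteq> X \<Longrightarrow> \<exists>U\<in>\<U>. C \<subseteq> U \<and> f (diameter U) \<le> f (diameter C) + e"
proof -
  obtain \<rho> where \<rho>: "0 < \<rho>"
    "\<And>C U. C \<subseteq> X \<Longrightarrow> U \<subseteq> X \<Longrightarrow> (\<And>u. u \<in> U \<Longrightarrow> \<exists>c\<in>C. dist u c \<le> \<rho>)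
      \<Longrightarrow> f (diameter U) \<le> f (diameter C) + e"
    using thickening[OF assms] by blast
  obtain N where N: "finite N" "X \<subseteq> (\<Union>x\<in>N. ball x (\<rho> / 2))"
    using X \<rho>(1) unfolding compact_eq_totally_bounded by (meson half_gt_zero)
  define B where "B T = (\<Union>x\<in>T. ball x (\<rho> / 2)) \<inter> X" for T
  show ?thesis
  proof (rule that[of "B ` Pow N"])
    fix C assume C: "C \<subseteq> X"
    define T where "T = {x \<in> N. ball x (\<rho> / 2) \<inter> C \<noteq> {}}"
    have "C \<subseteq> B T" using C N by (fastforce simp: B_def T_def)
    moreover have "f (diameter (B T)) \<le> f (diameter C) + e"
    proof (rule \<rho>(2)[OF C])
      fix u assume "u \<in> B T"
      then obtain x c where x: "dist x u < \<rho> / 2" "dist x c < \<rho> / 2" "c \<in> C"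
        by (auto simp: B_def T_def)
      then have "dist u c \<le> \<rho>"
        using dist_triangle[of u c x] by (simp add: dist_commute)
      then show "\<exists>c\<in>C. dist u c \<le> \<rho>" using x by blast
    qed (simp add: B_def)
    moreover have "T \<in> Pow N" by (auto simp: T_def)
    ultimately show "\<exists>U\<in>B ` Pow N. C \<subseteq> U \<and> f (diameter U) \<le> f (diameter C) + e" by blast
  qed (use N in \<open>auto simp: B_def\<close>)
qed

section \<open>The content as a capacity\<close>

abbreviation "Hinf \<equiv> hausdorff_content X f top"
abbreviation "Hmeas \<equiv> hausdorff_measure X f"

lemma Hinf_single:
  assumes "W \<subseteq> X"
  shows "Hinf W \<le> ennreal (f (diameter W))"
proof -
  define C where "C n = (if n = 0 then W else {})" for n :: nat
  have "Hinf W \<le> (\<Sum>n. ennreal (f (diameter (C n))))"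
    using assms by (intro hausdorff_content_le[OF bounded_X]) (auto simp: C_def split: if_splits)
  also have "\<dots> = (\<Sum>n\<in>{0}. ennreal (f (diameter (C n))))"
    by (rule suminf_finite) (auto simp: C_def f0)
  finally show ?thesis by (simp add: C_def)
qed

text \<open>Because \<open>f\<close> is monotone and positive off 0, a value below
  \<open>f d\<close> forces a diameter of at most \<open>d\<close>. A cover of total cost below
  \<open>f d\<close> is therefore automatically fine.\<close>

lemma Hmeas_eq_0_iff: "Hmeas A = 0 \<longleftrightarrow> Hinf A = 0"
proof
  assume "Hmeas A = 0"
  then show "Hinf A = 0"
    using hausdorff_content_le_measure[of top X f A] by simp
next
  assume A: "Hinf A = 0"
  have "Hmeas A \<le> 0"
  proof (rule hausdorff_measure_le, rule ennreal_le_epsilon)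
    fix \<delta> :: ennreal and e :: real assume "0 < \<delta>" "0 < e"
    obtain d where d: "0 < d" "ennreal d \<le> \<delta>"
      using \<open>0 < \<delta>\<close> by (rule ennreal_pos_lower_boundE)
    have "Hinf A < ennreal (min e (f d))" using A \<open>0 < e\<close> f_pos[OF d(1)] by simp
    then obtain C :: "nat \<Rightarrow> 'a set" where C: "A \<subseteq> (\<Union>n. C n)" "\<And>n. C n \<subseteq> X"
        and sum: "(\<Sum>n. ennreal (f (diameter (C n)))) < ennreal (min e (f d))"
      by (rule hausdorff_content_lessE) blast
    have "hausdorff_content X f \<delta> A \<le> (\<Sum>n. ennreal (f (diameter (C n))))"
    proof (rule hausdorff_content_le[OF bounded_X C])
      fix n
      have "ennreal (f (diameter (C n))) < ennreal (min e (f d))"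
        using sum by (rule ennreal_suminf_lessD)
      then have "f (diameter (C n)) < f d"
        using f_diameter_nonneg[OF C(2)] by (simp add: ennreal_less_iff)
      then have "diameter (C n) \<le> d"
        using f_mono[of d "diameter (C n)"] d by linarith
      then show "ennreal (diameter (C n)) \<le> \<delta>" using d(2) ennreal_leI order_trans by blast
    qed
    also have "\<dots> \<le> ennreal e" using sum by (meson less_imp_le order_trans ennreal_leI min.cobounded1)
    finally show "hausdorff_content X f \<delta> A \<le> 0 + ennreal e" by simp
  qed
  then show "Hmeas A = 0" by simp
qed

text \<open>A near-optimal cover of the intersection is enlarged to open sets at small extra cost.
  By compactness the open sets already cover some \<open>K n\<close>, whose content is at least
  \<open>c\<close>.\<close>

lemma Hinf_INT_decseq_ge:
  assumes K: "\<And>n :: nat. closed (K n)" "\<And>n. K n \<subseteq> X" "decseq K" and c: "\<And>n. c \<le> Hinf (K n)"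
  shows "c \<le> Hinf (\<Inter>n. K n)"
proof (rule ennreal_le_epsilon)
  fix e :: real assume "Hinf (\<Inter>n. K n) < top" and e: "0 < e"
  \<comment> \<open>Half of \<open>e\<close> pays for near-optimality, the other half for making the
    covering sets open.\<close>
  then have "Hinf (\<Inter>n. K n) < Hinf (\<Inter>n. K n) + ennreal (e / 2)"
    by (intro ennreal_less_add_pos) auto
  then obtain C :: "nat \<Rightarrow> 'a set" where C: "(\<Inter>n. K n) \<subseteq> (\<Union>i. C i)" "\<And>i. C i \<subseteq> X"
      and sum: "(\<Sum>i. ennreal (f (diameter (C i)))) < Hinf (\<Inter>n. K n) + ennreal (e / 2)"
    by (rule hausdorff_content_lessE) blast
  have "\<exists>W. open W \<and> C i \<subseteq> W \<and> f (diameter (W \<inter> X)) \<le> f (diameter (C i)) + e / 2 * (1/2) ^ Suc i" for i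
  proof -
    have "0 < e / 2 * (1/2) ^ Suc i" using e by simp
    then obtain \<rho> where \<rho>: "0 < \<rho>"
      "\<And>C U. C \<subseteq> X \<Longrightarrow> U \<subseteq> X \<Longrightarrow> (\<And>u. u \<in> U \<Longrightarrow> \<exists>c\<in>C. dist u c \<le> \<rho>)
        \<Longrightarrow> f (diameter U) \<le> f (diameter C) + e / 2 * (1/2) ^ Suc i"
      using thickening by blast
    let ?W = "\<Union>x\<in>C i. ball x \<rho>"
    have "f (diameter (?W \<inter> X)) \<le> f (diameter (C i)) + e / 2 * (1/2) ^ Suc i"
      by (rule \<rho>(2)[OF C(2)]) (auto simp: dist_commute intro: less_imp_le)
    moreover have "C i \<subseteq> ?W" using \<rho>(1) by auto
    ultimately show ?thesis by (intro exI[of _ ?W]) auto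
  qed
  then obtain W where W: "\<And>i. open (W i)" "\<And>i. C i \<subseteq> W i"
      "\<And>i. f (diameter (W i \<inter> X)) \<le> f (diameter (C i)) + e / 2 * (1/2) ^ Suc i"
    by metis
  obtain n where n: "K n \<subseteq> (\<Union>i. W i)"
  proof (rule ccontr)
    assume neg: "\<not> thesis"
    have "X \<inter> (\<Inter>n\<in>UNIV. K n - (\<Union>i. W i)) \<noteq> {}"
    proof (rule compact_imp_fip_image[OF X])
      show "closed (K n - (\<Union>i. W i))" for n using K(1) W(1) by (intro closed_Diff open_UN) auto
      fix I :: "nat set" assume "finite I"
      then obtain m where m: "\<And>i. i \<in> I \<Longrightarrow> i \<le> m" by (auto simp: finite_nat_set_iff_bounded_le)
      have "K m \<subseteq> K i" if "i \<in> I" for i using m[OF that] by (rule decseqD[OF K(3)])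
      moreover have "\<not> K m \<subseteq> (\<Union>i. W i)" using neg that by blast
      then obtain x where "x \<in> K m" "x \<notin> (\<Union>i. W i)" by (meson subsetI)
      ultimately have "x \<in> X \<inter> (\<Inter>n\<in>I. K n - (\<Union>i. W i))"
        using subsetD[OF K(2)] by auto
      then show "X \<inter> (\<Inter>n\<in>I. K n - (\<Union>i. W i)) \<noteq> {}" by blast
    qed
    then obtain x where x: "x \<in> (\<Inter>n. K n)" "x \<notin> (\<Union>i. W i)" by auto
    then obtain i where "x \<in> C i" using C(1) by blast
    then show False using subsetD[OF W(2)] x(2) by blast
  qed
  have "c \<le> Hinf (K n)" by (rule c)
  also have "\<dots> \<le> (\<Sum>i. ennreal (f (diameter (W i \<inter> X))))"
    using n K(2) by (intro hausdorff_content_le[OF bounded_X]) auto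
  also have "\<dots> \<le> (\<Sum>i. ennreal (f (diameter (C i))) + ennreal (e / 2 * (1/2) ^ Suc i))"
    using W(3) f_diameter_nonneg[OF C(2)] e
    by (intro suminf_le) (auto simp del: power_Suc simp flip: ennreal_plus intro: ennreal_leI)
  also have "\<dots> = (\<Sum>i. ennreal (f (diameter (C i)))) + (\<Sum>i. ennreal (e / 2 * (1/2) ^ Suc i))"
    by (rule suminf_add[symmetric]) auto
  also have "(\<Sum>i. ennreal (e / 2 * (1/2) ^ Suc i)) = ennreal (e / 2)"
    using e sums_mult[OF power_half_series, of "e / 2"]
    by (intro sums_unique[symmetric] sums_ennreal[THEN iffD2]) auto
  also have "(\<Sum>i. ennreal (f (diameter (C i)))) \<le> Hinf (\<Inter>n. K n) + ennreal (e / 2)"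
    using sum by simp
  finally have "c \<le> Hinf (\<Inter>n. K n) + ennreal (e / 2) + ennreal (e / 2)"
    by (simp add: add_right_mono)
  also have "\<dots> = Hinf (\<Inter>n. K n) + ennreal e"
    using e by (simp add: add.assoc flip: ennreal_plus)
  finally show "c \<le> Hinf (\<Inter>n. K n) + ennreal e" .
qed

text \<open>Covers of the \<open>E n\<close> are split into layers of sets of comparable size.
  After rounding to finite nets, the layers stabilise along a subsequence. What the limit layers
  leave uncovered has, by the small remaining sets, controlled Hausdorff measure, and that measure,
  being Borel regular, is continuous along increasing sequences.\<close>

lemma Hinf_UN_incseq_le:
  assumes inc: "incseq E" and E: "\<And>n. E n \<subseteq> X" and a: "\<And>n. Hinf (E n) \<le> a"
  shows "Hinf (\<Union>n. E n) \<le> a"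
proof (rule ennreal_le_epsilon)
  fix e' :: real assume "a < top" "0 < e'"
  \<comment> \<open>One half of \<open>e'\<close> is the slack of the covers, turning
    \<open>a\<close> into the real bound \<open>b\<close>; the other half pays for rounding to
    nets.\<close>
  define e where "e = e' / 2"
  have e: "0 < e" using \<open>0 < e'\<close> by (simp add: e_def)
  define b where "b = enn2real a + e"
  have b: "0 < b" using e by (simp add: b_def add_nonneg_pos)
  have ab: "a + ennreal e = ennreal b"
    using \<open>a < top\<close> e by (simp add: b_def ennreal_plus)
  have "\<exists>C :: nat \<Rightarrow> 'a set. E n \<subseteq> (\<Union>i. C i) \<and> (\<forall>i. C i \<subseteq> X) \<and>
      (\<Sum>i. ennreal (f (diameter (C i)))) < ennreal b" for n
  proof -
    have "Hinf (E n) < ennreal b"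
      using a[of n] ennreal_less_add_pos[OF \<open>a < top\<close> e] ab by simp
    then show ?thesis by (rule hausdorff_content_lessE) blast
  qed
  then obtain C :: "nat \<Rightarrow> nat \<Rightarrow> 'a set" where C: "\<And>n. E n \<subseteq> (\<Union>i. C n i)" "\<And>n i. C n i \<subseteq> X"
      and Csum: "\<And>n. (\<Sum>i. ennreal (f (diameter (C n i)))) < ennreal b"
    by metis
  define u where "u n i = f (diameter (C n i))" for n i
  have u: "0 \<le> u n i" for n i unfolding u_def by (rule f_diameter_nonneg[OF C(2)])
  define \<eta> where "\<eta> k = 1 / real (Suc k)" for k
  \<comment> \<open>Layer 0 holds the indices of value above 1, layer \<open>k > 0\<close> those
    with value in the interval (1/(k+1), 1/k]. \<open>T n K\<close> is what the first
    \<open>K\<close> layers leave over.\<close>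
  define L where "L n k = {i. \<eta> k < u n i \<and> (\<forall>j<k. u n i \<le> \<eta> j)}" for n k
  define T where "T n K = {i. \<forall>j<K. u n i \<le> \<eta> j}" for n K
  \<comment> \<open>Each member of layer \<open>k\<close> costs more than 1/(k+1) out of a total
    below \<open>b\<close>.\<close>
  have card_le: "real (card J) \<le> b * real (Suc k)" if "finite J" "J \<subseteq> L n k" for J n k
  proof -
    have "ennreal (real (card J) * \<eta> k) = (\<Sum>i\<in>J. ennreal (\<eta> k))"
      by (simp add: \<eta>_def ennreal_of_nat_eq_real_of_nat flip: ennreal_mult)
    also have "\<dots> \<le> (\<Sum>i\<in>J. ennreal (u n i))"
      using that by (intro sum_mono ennreal_leI) (auto simp: L_def)
    also have "\<dots> \<le> (\<Sum>i. ennreal (u n i))"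
      using that(1) by (intro sum_le_suminf) auto
    also have "\<dots> \<le> ennreal b" using Csum[of n] by (simp add: u_def)
    finally have "real (card J) * \<eta> k \<le> b" using b by simp
    then show ?thesis by (simp add: \<eta>_def field_simps)
  qed
  have L_fin: "finite (L n k)" for n k
  proof (rule ccontr)
    assume "infinite (L n k)"
    then obtain J where J: "finite J" "card J = Suc (nat \<lceil>b * real (Suc k)\<rceil>)" "J \<subseteq> L n k"
      using infinite_arbitrarily_large by blast
    have "real (card J) \<le> b * real (Suc k)" using J by (intro card_le)
    moreover have "b * real (Suc k) \<le> real (nat \<lceil>b * real (Suc k)\<rceil>)" by (rule real_nat_ceiling_ge)
    ultimately show False unfolding J(2) by linarith
  qed
  \<comment> \<open>Layer \<open>k\<close> has at most \<open>b * real (Suc k)\<close> members, so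
    rounding costs at most \<open>e * (1/2) ^ Suc k\<close> on this layer and \<open>e\<close> over
    all layers.\<close>
  define \<epsilon> where "\<epsilon> k = e * (1/2) ^ Suc k / (b * real (Suc k))" for k
  have \<epsilon>: "0 < \<epsilon> k" for k using e b by (simp add: \<epsilon>_def)
  have "\<exists>\<U>. finite \<U> \<and> (\<forall>U\<in>\<U>. U \<subseteq> X) \<and>
      (\<forall>C. C \<subseteq> X \<longrightarrow> (\<exists>U\<in>\<U>. C \<subseteq> U \<and> f (diameter U) \<le> f (diameter C) + \<epsilon> k))" for k
    by (rule finite_net[OF \<epsilon>[of k]]) blast
  then obtain \<U> where \<U>: "\<And>k. finite (\<U> k)" "\<And>k U. U \<in> \<U> k \<Longrightarrow> U \<subseteq> X"
      "\<And>k C. C \<subseteq> X \<Longrightarrow> \<exists>U\<in>\<U> k. C \<subseteq> U \<and> f (diameter U) \<le> f (diameter C) + \<epsilon> k"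
    by metis
  have ex: "\<exists>U. U \<in> \<U> k \<and> C n i \<subseteq> U \<and> f (diameter U) \<le> u n i + \<epsilon> k" for n k i
    unfolding u_def using \<U>(3)[OF C(2)[of n i], of k] by blast
  define U where "U n k i = (SOME U. U \<in> \<U> k \<and> C n i \<subseteq> U \<and> f (diameter U) \<le> u n i + \<epsilon> k)" for n k i
  have U: "U n k i \<in> \<U> k" "C n i \<subseteq> U n k i" "f (diameter (U n k i)) \<le> u n i + \<epsilon> k" for n k i
    using someI_ex[OF ex[of k n i]] by (simp_all only: U_def)
  define V where "V n k = U n k ` L n k" for n k
  have "finite (range (\<lambda>n. V n k))" for k
    by (rule finite_subset[of _ "Pow (\<U> k)"]) (use U(1) \<U>(1) in \<open>auto simp: V_def\<close>)
  then obtain w where w: "\<And>K m. \<exists>n\<ge>m. \<forall>k<K. V n k = w k"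
    using finite_range_cluster by metis
  have w_sub: "finite (w k)" "W \<in> w k \<Longrightarrow> W \<subseteq> X" for k W
  proof -
    obtain n where "V n k = w k" using w[of 0 "Suc k"] by auto
    then have "w k = U n k ` L n k" by (simp add: V_def)
    then have "w k \<subseteq> \<U> k" using U(1) by (simp add: image_subset_iff)
    then show "finite (w k)" using \<U>(1) by (rule finite_subset)
    show "W \<in> w k \<Longrightarrow> W \<subseteq> X" using \<open>w k \<subseteq> \<U> k\<close> by (intro \<U>(2)[of W k]) (rule subsetD)
  qed
  define s where "s k = (\<Sum>W\<in>w k. ennreal (f (diameter W)))" for k
  \<comment> \<open>The part of \<open>E m\<close> that the limit families, over all layers
    together, fail to cover.\<close>
  define F where "F m = E m - (\<Union>k. \<Union>(w k))" for m
  have V_sum: "(\<Sum>W\<in>V n k. ennreal (f (diameter W))) \<le> (\<Sum>i\<in>L n k. ennreal (u n i)) + ennreal (e * (1/2) ^ Suc k)"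
    for n k
  proof -
    have "(\<Sum>W\<in>V n k. ennreal (f (diameter W))) \<le> (\<Sum>i\<in>L n k. ennreal (f (diameter (U n k i))))"
      unfolding V_def using sum_image_le[OF L_fin, of n k "\<lambda>W. ennreal (f (diameter W))" "U n k"]
      by (simp add: o_def)
    also have "\<dots> \<le> (\<Sum>i\<in>L n k. ennreal (u n i) + ennreal (\<epsilon> k))"
      using U(3) u \<epsilon> by (intro sum_mono) (auto simp: less_imp_le simp flip: ennreal_plus intro!: ennreal_leI)
    also have "\<dots> = (\<Sum>i\<in>L n k. ennreal (u n i)) + ennreal (real (card (L n k)) * \<epsilon> k)"
      using \<epsilon>[of k] by (simp add: sum.distrib ennreal_of_nat_eq_real_of_nat ennreal_mult less_imp_le)
    also have "real (card (L n k)) * \<epsilon> k \<le> b * real (Suc k) * \<epsilon> k"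
      using \<epsilon>[of k] card_le[OF L_fin subset_refl] by (intro mult_right_mono) auto
    also have "b * real (Suc k) * \<epsilon> k = e * (1/2) ^ Suc k"
      using b by (simp add: \<epsilon>_def)
    finally show ?thesis by (simp add: add_left_mono ennreal_leI)
  qed
  \<comment> \<open>A single cover, of index \<open>n\<close>, pays for both terms: its small sets
    cover \<open>F m\<close>, and its first layers, after rounding, are exactly the families
    \<open>w k\<close>. As the two groups of indices are disjoint, the total is at most
    \<open>b\<close> plus the rounding cost.\<close>
  have main: "hausdorff_content X f \<delta> (F m) + (\<Sum>k<K. s k) \<le> ennreal (b + e)" if "0 < \<delta>" for \<delta> m K
  proof -
    obtain d where d: "0 < d" "ennreal d \<le> \<delta>"
      using \<open>0 < \<delta>\<close> by (rule ennreal_pos_lower_boundE)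
    obtain N where N: "\<eta> N < f d" unfolding \<eta>_def using nat_approx_posE[OF f_pos[OF d(1)]] by blast
    \<comment> \<open>Going past layer \<open>N\<close> leaves only values at most
      \<open>\<eta> N < f d\<close>, hence diameters at most \<open>d\<close>.\<close>
    define K' where "K' = max K (Suc N)"
    obtain n where n: "m \<le> n" "\<And>k. k < K' \<Longrightarrow> V n k = w k" using w[of m K'] by blast
    define D where "D i = (if i \<in> T n K' then C n i else {})" for i
    have TL: "i \<notin> T n K' \<longleftrightarrow> (\<exists>k<K'. i \<in> L n k)" for i
    proof
      assume "i \<notin> T n K'"
      then obtain j where j: "j < K'" "\<eta> j < u n i" by (auto simp: T_def not_le)
      define k where "k = (LEAST j. \<eta> j < u n i)"
      have "\<eta> k < u n i" "k \<le> j" unfolding k_def using j(2) by (auto intro: LeastI Least_le)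
      moreover have "u n i \<le> \<eta> l" if "l < k" for l
        using not_less_Least[OF that[unfolded k_def]] by simp
      ultimately show "\<exists>k<K'. i \<in> L n k" using j(1) by (intro exI[of _ k]) (auto simp: L_def)
    qed (auto simp: T_def L_def not_le)
    have disj: "L n k \<inter> L n l = {}" if "k \<noteq> l" for k l
      using that by (cases k l rule: linorder_cases) (fastforce simp: L_def)+
    \<comment> \<open>A set from one of the first \<open>K'\<close> layers lies inside a member of
      some \<open>w k\<close>, which \<open>F m\<close> avoids; so the leftover sets alone cover
      \<open>F m\<close>.\<close>
    have "hausdorff_content X f \<delta> (F m) \<le> (\<Sum>i. ennreal (f (diameter (D i))))"
    proof (rule hausdorff_content_le[OF bounded_X])
      show "F m \<subseteq> (\<Union>i. D i)"
      proof
        fix x assume x: "x \<in> F m"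
        then have "x \<in> E n" using incseqD[OF inc n(1)] by (auto simp: F_def)
        then obtain i where i: "x \<in> C n i" using C(1) by blast
        have "i \<in> T n K'"
        proof (rule ccontr)
          assume "i \<notin> T n K'"
          then obtain k where k: "k < K'" "i \<in> L n k" using TL by blast
          then have "U n k i \<in> w k" using n(2) by (auto simp: V_def)
          moreover have "x \<in> U n k i" using i U(2) by blast
          ultimately show False using x by (auto simp: F_def)
        qed
        then have "x \<in> D i" using i by (simp add: D_def)
        then show "x \<in> (\<Union>i. D i)" by blast
      qed
      fix i
      show "D i \<subseteq> X" using C(2) by (simp add: D_def)
      show "ennreal (diameter (D i)) \<le> \<delta>"
      proof (cases "i \<in> T n K'")
        case True
        then have "u n i \<le> \<eta> N" by (simp add: T_def K'_def)
        then have "f (diameter (C n i)) < f d"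
          using N by (simp add: u_def)
        then have "diameter (C n i) \<le> d"
          using f_mono[of d "diameter (C n i)"] d by linarith
        then show ?thesis using True order_trans[OF ennreal_leI d(2)] by (simp add: D_def)
      qed (simp add: D_def)
    qed
    also have "\<dots> = (\<Sum>i. if i \<in> T n K' then ennreal (u n i) else 0)"
      by (intro suminf_cong) (simp add: D_def u_def f0)
    finally have tail: "hausdorff_content X f \<delta> (F m) \<le> (\<Sum>i. if i \<in> T n K' then ennreal (u n i) else 0)" .
    have "(\<Sum>k<K. s k) \<le> (\<Sum>k<K'. s k)"
      by (rule sum_mono2) (auto simp: K'_def)
    also have "\<dots> \<le> (\<Sum>k<K'. (\<Sum>i\<in>L n k. ennreal (u n i)) + ennreal (e * (1/2) ^ Suc k))"
    proof (rule sum_mono)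
      fix k assume "k \<in> {..<K'}"
      then have "w k = V n k" using n(2) by simp
      then show "s k \<le> (\<Sum>i\<in>L n k. ennreal (u n i)) + ennreal (e * (1/2) ^ Suc k)"
        unfolding s_def using V_sum[of n k] by (simp only:)
    qed
    also have "\<dots> = (\<Sum>k<K'. \<Sum>i\<in>L n k. ennreal (u n i)) + (\<Sum>k<K'. ennreal (e * (1/2) ^ Suc k))"
      by (rule sum.distrib)
    also have "(\<Sum>k<K'. \<Sum>i\<in>L n k. ennreal (u n i)) = (\<Sum>i\<in>(\<Union>k<K'. L n k). ennreal (u n i))"
      using L_fin disj by (intro sum.UNION_disjoint[symmetric]) auto
    \<comment> \<open>Large and small indices are written as series over all \<open>i\<close> with
      complementary supports, so that they add up to the full series.\<close>
    also have "\<dots> = (\<Sum>i\<in>(\<Union>k<K'. L n k). if i \<in> T n K' then 0 else ennreal (u n i))"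
      using TL by (intro sum.cong) auto
    also have "\<dots> = (\<Sum>i. if i \<in> T n K' then 0 else ennreal (u n i))"
      using TL L_fin by (intro suminf_finite[symmetric]) auto
    also have "(\<Sum>k<K'. ennreal (e * (1/2) ^ Suc k)) \<le> (\<Sum>k. ennreal (e * (1/2) ^ Suc k))"
      by (rule sum_le_suminf) auto
    also have "\<dots> = ennreal e"
      using e sums_mult[OF power_half_series, of e]
      by (intro sums_unique[symmetric] sums_ennreal[THEN iffD2]) auto
    finally have "(\<Sum>k<K. s k) \<le> (\<Sum>i. if i \<in> T n K' then 0 else ennreal (u n i)) + ennreal e"
      by (simp add: add_left_mono)
    then have "hausdorff_content X f \<delta> (F m) + (\<Sum>k<K. s k) \<le>
        (\<Sum>i. if i \<in> T n K' then ennreal (u n i) else 0) +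
        (\<Sum>i. if i \<in> T n K' then 0 else ennreal (u n i)) + ennreal e"
      using add_mono[OF tail] by (simp only: add.assoc)
    also have "(\<Sum>i. if i \<in> T n K' then ennreal (u n i) else 0) +
        (\<Sum>i. if i \<in> T n K' then 0 else ennreal (u n i)) = (\<Sum>i. ennreal (u n i))"
      by (subst suminf_add) (auto intro!: suminf_cong)
    also have "\<dots> \<le> ennreal b" using Csum[of n] by (simp add: u_def)
    finally show ?thesis using b e by (simp add: add_right_mono)
  qed
  have bound: "Hinf (\<Union>m. F m) + (\<Sum>k<K. s k) \<le> ennreal (b + e)" for K
  proof -
    \<comment> \<open>Subtraction in \<open>ennreal\<close> is truncated at 0; this bound makes it
      possible to add the partial sum back.\<close>
    have sK: "(\<Sum>k<K. s k) \<le> ennreal (b + e)" 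
      by (rule order_trans[OF add_increasing[OF zero_le order_refl] main[of 1 0 K]]) simp
    have "Hmeas (F m) \<le> ennreal (b + e) - (\<Sum>k<K. s k)" for m
      using main by (intro hausdorff_measure_le ennreal_le_minus_iff[THEN iffD2] disjI1)
    moreover have "incseq F" using inc by (auto simp: F_def incseq_def)
    ultimately have "Hmeas (\<Union>m. F m) \<le> ennreal (b + e) - (\<Sum>k<K. s k)"
      by (intro hausdorff_measure_UN_incseq_le) (simp_all add: bounded_X closed_X f0)
    then have "Hinf (\<Union>m. F m) \<le> ennreal (b + e) - (\<Sum>k<K. s k)"
      by (intro order_trans[OF hausdorff_content_le_measure]) simp_all
    then have "Hinf (\<Union>m. F m) + (\<Sum>k<K. s k) \<le> ennreal (b + e) - (\<Sum>k<K. s k) + (\<Sum>k<K. s k)"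
      by (rule add_right_mono)
    then show ?thesis using sK by (simp add: diff_add_cancel_ennreal)
  qed
  note empty = hausdorff_content_empty[of f, OF f0] and subadd = hausdorff_content_subadd[OF bounded_X]
  have "(\<Union>n. E n) \<subseteq> (\<Union>m. F m) \<union> (\<Union>k. \<Union>(w k))" by (auto simp: F_def)
  then have "Hinf (\<Union>n. E n) \<le> Hinf ((\<Union>m. F m) \<union> (\<Union>k. \<Union>(w k)))" by (rule hausdorff_content_mono)
  also have "\<dots> \<le> Hinf (\<Union>m. F m) + Hinf (\<Union>k. \<Union>(w k))" by (rule Un_le_add[OF empty subadd])
  also have "Hinf (\<Union>k. \<Union>(w k)) \<le> (\<Sum>k. s k)"
  proof -
    have "Hinf (\<Union>(w k)) \<le> s k" for k
    proof -
      have "Hinf (\<Union>W\<in>w k. W) \<le> (\<Sum>W\<in>w k. Hinf W)"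
        by (rule finite_Union_le_sum[OF empty subadd w_sub(1)])
      also have "\<dots> \<le> s k" unfolding s_def by (intro sum_mono Hinf_single w_sub)
      finally show ?thesis by simp
    qed
    then have "(\<Sum>k. Hinf (\<Union>(w k))) \<le> (\<Sum>k. s k)" by (intro suminf_le) auto
    then show ?thesis by (rule order_trans[OF subadd])
  qed
  also have "Hinf (\<Union>m. F m) + (\<Sum>k. s k) \<le> ennreal (b + e)"
    using ennreal_suminf_bound_add[of s "Hinf (\<Union>m. F m)"] bound by (simp add: add.commute)
  also have "ennreal (b + e) = a + ennreal e'"
    using ab b e by (simp add: e_def ennreal_plus[symmetric] add.assoc flip: ab)
  finally show "Hinf (\<Union>n. E n) \<le> a + ennreal e'" by (simp add: add_left_mono)
qed

text \<open>The strict bound \<open>c <\<close> survives each finite stage by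
  \<open>Hinf_UN_incseq_le\<close>; the limit stage loses strictness through
  \<open>Hinf_INT_decseq_ge\<close>. The witnesses \<open>x\<close> and \<open>z\<close> are bounded
  together, so that they range over a compact set and a limit triple exists in
  \<open>C\<close>.\<close>

lemma Hinf_projection_bounded:
  fixes C :: "(((nat \<Rightarrow> nat) \<times> 'a) \<times> (nat \<Rightarrow> nat)) set"
  assumes C: "closed C" "C \<subseteq> (UNIV \<times> X) \<times> UNIV"
    and c: "c < Hinf {y. \<exists>x z. ((x, y), z) \<in> C}"
  obtains g where "c \<le> Hinf {y. \<exists>x z. ((x, y), z) \<in> C \<and> x \<le> g \<and> z \<le> g}"
proof -
  define P where "P g k = {y. \<exists>x z. ((x, y), z) \<in> C \<and> (\<forall>i<k. x i \<le> g i \<and> z i \<le> g i)}"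
    for g :: "nat \<Rightarrow> nat" and k
  have P_sub: "P g k \<subseteq> X" for g k using C(2) by (auto simp: P_def)
  \<comment> \<open>\<open>P g k\<close> looks only at coordinates below \<open>k\<close>, so stage
    \<open>k\<close> is free to reset coordinate \<open>k\<close> and leaves all others
    alone.\<close>
  have "\<exists>G. \<forall>k. c < Hinf (P (G k) k) \<and> (\<forall>i. i \<noteq> k \<longrightarrow> G (Suc k) i = G k i)"
  proof (rule dependent_nat_choice)
    show "\<exists>g. c < Hinf (P g 0)" using c by (simp add: P_def)
    fix g k assume g: "c < Hinf (P g k)"
    define E where "E m = P (g(k := m)) (Suc k)" for m
    have "incseq E"
      unfolding incseq_Suc_iff
    proof (intro allI subsetI)
      fix m y assume "y \<in> E m"
      then obtain x z where xz: "((x, y), z) \<in> C"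
          "\<forall>i<Suc k. x i \<le> (g(k := m)) i \<and> z i \<le> (g(k := m)) i"
        by (auto simp: E_def P_def)
      then have "\<forall>i<Suc k. x i \<le> (g(k := Suc m)) i \<and> z i \<le> (g(k := Suc m)) i"
        by (simp add: less_Suc_eq le_SucI)
      then show "y \<in> E (Suc m)" using xz(1) unfolding E_def P_def by blast
    qed
    moreover have "P g k \<subseteq> (\<Union>m. E m)"
    proof
      fix y assume "y \<in> P g k"
      then obtain x z where xz: "((x, y), z) \<in> C" "\<forall>i<k. x i \<le> g i \<and> z i \<le> g i"
        by (auto simp: P_def)
      let ?m = "max (x k) (z k)"
      have "\<forall>i<Suc k. x i \<le> (g(k := ?m)) i \<and> z i \<le> (g(k := ?m)) i"
        using xz(2) by (simp add: less_Suc_eq)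
      then have "y \<in> E ?m" using xz(1) unfolding E_def P_def by blast
      then show "y \<in> (\<Union>m. E m)" by blast
    qed
    then have "c < Hinf (\<Union>m. E m)"
      using g hausdorff_content_mono less_le_trans by blast
    ultimately obtain m where "c < Hinf (E m)"
      using Hinf_UN_incseq_le[of E c] P_sub by (metis E_def not_le)
    then show "\<exists>g'. c < Hinf (P g' (Suc k)) \<and> (\<forall>i. i \<noteq> k \<longrightarrow> g' i = g i)"
      by (intro exI[of _ "g(k := m)"]) (simp add: E_def)
  qed
  then obtain G where G: "\<And>k. c < Hinf (P (G k) k)"
      "\<And>k i. i \<noteq> k \<Longrightarrow> G (Suc k) i = G k i"
    by blast
  \<comment> \<open>Coordinate \<open>i\<close> is chosen in passing from stage \<open>i\<close> to
    stage \<open>Suc i\<close> and is final from then on.\<close>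
  define g where "g i = G (Suc i) i" for i
  have gG: "G k i = g i" if "i < k" for k i
    using that by (induction k) (auto simp: g_def less_Suc_eq G(2))
  have "P (G k) k = P g k" for k unfolding P_def using gG by simp
  then have cP: "c < Hinf (P g k)" for k using G(1) by simp
  have "c \<le> Hinf (\<Inter>k. closure (P g k))"
  proof (rule Hinf_INT_decseq_ge)
    show "closure (P g k) \<subseteq> X" for k using P_sub closed_X by (rule closure_minimal)
    have "P g (Suc k) \<subseteq> P g k" for k unfolding P_def using less_SucI by blast
    then show "decseq (\<lambda>k. closure (P g k))" by (intro decseq_SucI closure_mono)
    show "c \<le> Hinf (closure (P g k))" for k
      using cP[of k] hausdorff_content_mono[OF closure_subset, of X f top "P g k"] by simp
  qed simp
  also have "\<dots> \<le> Hinf {y. \<exists>x z. ((x, y), z) \<in> C \<and> x \<le> g \<and> z \<le> g}"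
  proof (rule hausdorff_content_mono, rule subsetI)
    fix y assume y: "y \<in> (\<Inter>k. closure (P g k))"
    \<comment> \<open>A point of all the closures need not have a bounded witness at once. It is
      approximated by points with witnesses bounded in the first \<open>k\<close> coordinates, and
      compactness supplies a limit witness.\<close>
    have "\<forall>k. \<exists>p. p \<in> C \<and> (\<forall>i<k. fst (fst p) i \<le> g i \<and> snd p i \<le> g i)
        \<and> dist (snd (fst p)) y < 1 / real (Suc k)"
    proof
      fix k
      have "y \<in> closure (P g k)" using y by blast
      then obtain y' where y': "y' \<in> P g k" "dist y' y < 1 / real (Suc k)"
        by (meson closure_approachable of_nat_0_less_iff zero_less_Suc zero_less_divide_1_iff)
      then obtain x z where "((x, y'), z) \<in> C" "\<forall>i<k. x i \<le> g i \<and> z i \<le> g i"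
        by (auto simp: P_def)
      then show "\<exists>p. p \<in> C \<and> (\<forall>i<k. fst (fst p) i \<le> g i \<and> snd p i \<le> g i)
          \<and> dist (snd (fst p)) y < 1 / real (Suc k)"
        using y'(2) by (intro exI[of _ "((x, y'), z)"]) auto
    qed
    from choice[OF this] obtain p where p: "\<forall>k. p k \<in> C
        \<and> (\<forall>i<k. fst (fst (p k)) i \<le> g i \<and> snd (p k) i \<le> g i)
        \<and> dist (snd (fst (p k))) y < 1 / real (Suc k)" ..
    define x where "x k = fst (fst (p k))" for k
    define y' where "y' k = snd (fst (p k))" for k
    define z where "z k = snd (p k)" for k
    have xyz: "((x k, y' k), z k) \<in> C" "i < k \<Longrightarrow> x k i \<le> g i \<and> z k i \<le> g i"
        "dist (y' k) y < 1 / real (Suc k)" for k i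
      using p[rule_format, of k] by (simp_all add: x_def y'_def z_def)
    \<comment> \<open>Coordinate \<open>i\<close> is bounded by \<open>g i\<close> only from
      approximant \<open>i + 1\<close> on; the earlier ones contribute finitely many further
      values.\<close>
    have "finite (range (\<lambda>n. (x n i, z n i)))" for i
    proof -
      have "range (\<lambda>n. (x n i, z n i)) \<subseteq> (\<lambda>n. (x n i, z n i)) ` {..i} \<union> {..g i} \<times> {..g i}"
      proof (rule image_subsetI)
        fix n
        show "(x n i, z n i) \<in> (\<lambda>n. (x n i, z n i)) ` {..i} \<union> {..g i} \<times> {..g i}"
          using xyz(2)[of i n] by (cases "n \<le> i") simp_all
      qed
      then show ?thesis by (rule finite_subset) auto
    qed
    from finite_range_cluster[of "\<lambda>n i. (x n i, z n i)", OF this]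
    obtain w where w: "\<forall>K m. \<exists>n\<ge>m. \<forall>i<K. (x n i, z n i) = w i" ..
    \<comment> \<open>Taking \<open>h K\<close> above \<open>K\<close> makes the middle components
      converge to \<open>y\<close> and puts coordinate \<open>i\<close> of approximant
      \<open>h (Suc i)\<close> under the bound \<open>g i\<close>.\<close>
    define h where "h K = (SOME n. n \<ge> Suc K \<and> (\<forall>i<K. (x n i, z n i) = w i))" for K
    have "Suc K \<le> h K \<and> (\<forall>i<K. (x (h K) i, z (h K) i) = w i)" for K
      unfolding h_def by (rule someI_ex) (rule w[rule_format])
    then have h: "Suc K \<le> h K" "i < K \<Longrightarrow> (x (h K) i, z (h K) i) = w i" for K i
      by blast+
    define x' where "x' i = fst (w i)" for i
    define z' where "z' i = snd (w i)" for i
    have ev: "eventually (\<lambda>K. x (h K) i = x' i \<and> z (h K) i = z' i) sequentially" for i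
      using eventually_gt_at_top[of i]
    proof eventually_elim
      case (elim K)
      show ?case using h(2)[OF elim] by (simp add: x'_def z'_def prod_eq_iff)
    qed
    have "(\<lambda>K. x (h K)) \<longlonglongrightarrow> x'"
      using ev by (intro tendsto_componentwise_fun tendsto_eventually) (simp add: eventually_conj_iff)
    moreover have "(\<lambda>K. z (h K)) \<longlonglongrightarrow> z'"
      using ev by (intro tendsto_componentwise_fun tendsto_eventually) (simp add: eventually_conj_iff)
    moreover have "(\<lambda>K. y' (h K)) \<longlonglongrightarrow> y"
    proof (rule metric_tendsto_imp_tendsto[OF LIMSEQ_inverse_real_of_nat])
      show "eventually (\<lambda>K. dist (y' (h K)) y \<le> dist (inverse (real (Suc K))) 0) sequentially"
      proof (rule always_eventually, rule allI)
        fix K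
        have "1 / real (Suc (h K)) \<le> 1 / real (Suc K)"
          using h(1)[of K] by (intro divide_left_mono) auto
        then show "dist (y' (h K)) y \<le> dist (inverse (real (Suc K))) 0"
          using xyz(3)[of "h K"] by (simp add: dist_real_def inverse_eq_divide)
      qed
    qed
    ultimately have "(\<lambda>K. ((x (h K), y' (h K)), z (h K))) \<longlonglongrightarrow> ((x', y), z')"
      by (intro tendsto_Pair)
    then have "((x', y), z') \<in> C"
      using closed_sequentially[OF C(1), of "\<lambda>K. ((x (h K), y' (h K)), z (h K))"] xyz(1) by simp
    moreover have "x' i \<le> g i \<and> z' i \<le> g i" for i
    proof -
      have "x (h (Suc i)) i = x' i" "z (h (Suc i)) i = z' i"
        using h(2)[of i "Suc i"] by (simp_all add: x'_def z'_def prod_eq_iff)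
      moreover have "i < h (Suc i)" using h(1)[of "Suc i"] by simp
      ultimately show ?thesis using xyz(2)[of i "h (Suc i)"] by simp
    qed
    ultimately show "y \<in> {y. \<exists>x z. ((x, y), z) \<in> C \<and> x \<le> g \<and> z \<le> g}"
      by (auto simp: le_fun_def)
  qed
  finally show thesis by (rule that)
qed

end

section \<open>From capacitability to null unions\<close>

theorem theorem3p2:
  fixes f :: "real \<Rightarrow> real"
    and X :: "'a::metric_space set"
    and A :: "((nat \<Rightarrow> nat) \<times> 'a) set"
  assumes "gauge_function f" and "continuous_on {0..} f" and "doubling f"
    and "compact X"
    and "A \<subseteq> UNIV \<times> X" and "Sigma11_in (UNIV \<times> X) A"
    and "\<And>x x'. x \<le> x' \<Longrightarrow> A `` {x} \<subseteq> A `` {x'}"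
    and "\<And>x. hausdorff_measure X f (A `` {x}) = 0"
  shows "hausdorff_measure X f (\<Union>x. A `` {x}) = 0"
proof -
  interpret compact_gauge X f
  proof
    show "f 0 = 0" "\<And>s t. 0 \<le> s \<Longrightarrow> s \<le> t \<Longrightarrow> f s \<le> f t"
      using assms(1) by (auto simp: gauge_function_def mono_on_def)
    fix t :: real assume t: "0 < t"
    obtain r where r: "0 < r" "f (2 * t) < r * f t" using assms(3) t by (auto simp: doubling_def)
    have "0 \<le> f (2 * t)" using assms(1) t by (simp add: gauge_function_def)
    then have "0 < r * f t" using r(2) by simp
    then show "0 < f t" using r(1) by (simp add: zero_less_mult_iff)
  qed (use assms in auto)
  obtain C where C: "closedin (top_of_set ((UNIV \<times> X) \<times> (UNIV :: (nat \<Rightarrow> nat) set))) C" "A = fst ` C"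
    using assms(6) by (auto simp: Sigma11_in_def)
  have "closed C"
    by (rule closedin_closed_trans[OF C(1)]) (intro closed_Times closed_X closed_UNIV)
  have "C \<subseteq> (UNIV \<times> X) \<times> UNIV" using C(1) by (rule closedin_imp_subset)
  have "(\<Union>x. A `` {x}) = {y. \<exists>x z. ((x, y), z) \<in> C}" unfolding C(2) by force
  moreover have "Hinf {y. \<exists>x z. ((x, y), z) \<in> C} = 0"
  proof (rule ccontr)
    assume "Hinf {y. \<exists>x z. ((x, y), z) \<in> C} \<noteq> 0"
    \<comment> \<open>The bound obtained at the limit is only \<open>c \<le>\<close>, so a positive
      \<open>c\<close> strictly below the content is fixed to contradict nullness of the section at
      \<open>g\<close>.\<close>
    then obtain c where c: "0 < c" "c < Hinf {y. \<exists>x z. ((x, y), z) \<in> C}"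
      using dense[of 0 "Hinf {y. \<exists>x z. ((x, y), z) \<in> C}"] by (auto simp: zero_less_iff_neq_zero)
    obtain g where g: "c \<le> Hinf {y. \<exists>x z. ((x, y), z) \<in> C \<and> x \<le> g \<and> z \<le> g}"
      using Hinf_projection_bounded[OF \<open>closed C\<close> \<open>C \<subseteq> _\<close> c(2)] by blast
    have "{y. \<exists>x z. ((x, y), z) \<in> C \<and> x \<le> g \<and> z \<le> g} \<subseteq> A `` {g}"
    proof
      fix y assume "y \<in> {y. \<exists>x z. ((x, y), z) \<in> C \<and> x \<le> g \<and> z \<le> g}"
      then obtain x z where xz: "((x, y), z) \<in> C" "x \<le> g" by blast
      then have "y \<in> A `` {x}" unfolding C(2) by force
      then show "y \<in> A `` {g}" using assms(7)[OF xz(2)] by blast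
    qed
    then have "c \<le> Hinf (A `` {g})" using g hausdorff_content_mono order_trans by blast
    then show False using assms(8)[of g] c(1) by (simp add: Hmeas_eq_0_iff)
  qed
  ultimately show ?thesis by (simp add: Hmeas_eq_0_iff)
qed

end
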